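(* The set $\{p\in[0,1]\mid \mathbb{T}(p)\ge\frac12\}$ of quantile thresholds that are $\frac12$-competitive is an interval of length at least $\frac12$.
   Context: There are $n\ge 1$ boxes with independent nonnegative rewards $v_1,\dots,v_n$ whose distributions have no point masses. $Z=\max_{i\in[n]}v_i$ (the prophet), normalized so that $\mathbb{E}[Z]=1$. The quantile function of $Z$ is $Q(p)=\sup\{x\mid \Pr[Z\le x]=p\}$ for $p\in[0,1]$ (values in $\mathbb{R}_{\ge0}\cup\{\infty\}$). Define $\mathbb{T}:[0,1]\to\mathbb{R}_{\ge0}$ by $\mathbb{T}(p)=p\int_p^1 \frac{Q(q)}{q^2}\,dq$ for $p\in(0,1]$, with $\mathbb{T}(0)=\lim_{p\to0^+}\mathbb{T}(p)$. The value $\mathbb{T}(p)$ is the (distribution-of-$Z$-based, worst-case) guarantee on the expected reward of the algorithm accepting the first reward exceeding $Q(p)$; a quantile $p$ is called $\frac12$-competitive when $\mathbb{T}(p)\ge\frac12=\frac12\mathbb{E}[Z]$. *)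

theory Defs
  imports "HOL-Probability.Probability"
begin

definition prophet :: "nat \<Rightarrow> (nat \<Rightarrow> 'a \<Rightarrow> real) \<Rightarrow> 'a \<Rightarrow> real" where
  "prophet n v \<omega> = Max ((\<lambda>i. v i \<omega>) ` {1..n})"

text \<open>
  The supremum ranges over all \<open>x\<close> in the extended half-line, so that the set is never empty at
  \<open>p = 1\<close> and the quantile there is \<open>\<infinity>\<close>, also when \<open>Z\<close> is unbounded.
\<close>
definition quantile :: "'a measure \<Rightarrow> ('a \<Rightarrow> real) \<Rightarrow> real \<Rightarrow> ennreal" where
  "quantile M Z p = Sup {x. measure M {\<omega> \<in> space M. ennreal (Z \<omega>) \<le> x} = p}"

text \<open>
  The guarantee is \<open>ennreal\<close>-valued because its integrand is; for \<open>p > 0\<close> it is finite as soon as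
  \<open>Z\<close> has finite expectation, since the integrand is at most the quantile divided by \<open>p\<^sup>2\<close>.
\<close>
definition guarantee_pos :: "'a measure \<Rightarrow> ('a \<Rightarrow> real) \<Rightarrow> real \<Rightarrow> ennreal" where
  "guarantee_pos M Z p =
     ennreal p * (\<integral>\<^sup>+q\<in>{p..1}. (quantile M Z q / ennreal (q\<^sup>2)) \<partial>lborel)"

definition guarantee :: "'a measure \<Rightarrow> ('a \<Rightarrow> real) \<Rightarrow> real \<Rightarrow> ennreal" where
  "guarantee M Z p =
     (if p = 0 then Lim (at_right 0) (guarantee_pos M Z) else guarantee_pos M Z p)"

end

theory Submission
  imports Defs
begin

text \<open>
  Let \<open>F\<close> be the distribution function of \<open>Z\<close>. Writing \<open>Q(q)\<close> as the length of
  \<open>{t \<ge> 0. F(t) \<le> q}\<close> and exchanging integrals turns the guarantee into a mixture of tents: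
  \<open>\<T>(p) = \<integral>\<^sub>0\<^sup>\<infinity> tent p (F t) dt\<close>, where \<open>tent p r\<close> is piecewise linear in \<open>p\<close>, with value \<open>0\<close> at
  \<open>p = 0\<close> and \<open>p = 1\<close> and peak \<open>1 - r\<close> at \<open>p = r\<close>. Hence the guarantee is concave and its superlevel
  sets are intervals. For \<open>a \<in> [0,1/2]\<close>, every tent satisfies
  \<open>2a tent a r + (1 - 2a) tent (a + 1/2) r \<ge> (1 - r)/2\<close>; since \<open>\<integral>\<^sub>0\<^sup>\<infinity> (1 - F t) dt = E[Z]\<close>, one of \<open>a\<close> and
  \<open>a + 1/2\<close> is competitive. An interval in \<open>[0,1]\<close> that meets each such pair has length at least \<open>1/2\<close>.
\<close>

section \<open>Lebesgue measure of initial segments and intervals\<close>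

text \<open>The set differs from the half-open interval between 0 and \<open>x\<close> in at most
  the endpoint. This turns the supremum that defines the quantile into a length, also when it is
  infinite.\<close>

lemma emeasure_lborel_initial_segment:
  fixes x :: ennreal and A :: "real set"
  assumes [measurable]: "A \<in> sets borel"
    and lower: "\<And>t. 0 \<le> t \<Longrightarrow> ennreal t < x \<Longrightarrow> t \<in> A"
    and upper: "\<And>t. t \<in> A \<Longrightarrow> 0 \<le> t \<and> ennreal t \<le> x"
  shows "emeasure lborel A = x"
proof (cases x)
  case (real r)
  have "{0..<r} \<subseteq> A" using lower real by (auto simp: ennreal_less_iff)
  then have "emeasure lborel {0..<r} \<le> emeasure lborel A" by (intro emeasure_mono) auto
  moreover have "A \<subseteq> {0..r}" using upper real by fastforce
  then have "emeasure lborel A \<le> emeasure lborel {0..r}" by (intro emeasure_mono) auto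
  ultimately show ?thesis using real by simp
next
  case top
  have "of_nat n \<le> emeasure lborel A" for n
  proof -
    have "{0..real n} \<subseteq> A" using lower top by auto
    then have "emeasure lborel {0..real n} \<le> emeasure lborel A"
      by (intro emeasure_mono) auto
    then show ?thesis by (simp add: ennreal_of_nat_eq_real_of_nat)
  qed
  then have "(SUP n. of_nat n) \<le> emeasure lborel A" by (rule SUP_least)
  then show ?thesis using top by (simp add: ennreal_SUP_of_nat_eq_top top_unique)
qed

lemma interval_measure_ge_half:
  fixes S :: "real set"
  assumes S: "S \<subseteq> {0..1}" "is_interval S"
    and cover: "\<And>a. 0 \<le> a \<Longrightarrow> a \<le> 1/2 \<Longrightarrow> a \<in> S \<or> a + 1/2 \<in> S"
  shows "1/2 \<le> measure lborel S"
proof -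
  \<comment> \<open>If 1/2 were missing, the pairs for \<open>a = 0\<close> and
    \<open>a = 1/2\<close> would put both 0 and 1 into \<open>S\<close>.\<close>
  have half: "1/2 \<in> S"
    using cover[of 0] cover[of "1/2"] S(2)[unfolded is_interval_1, rule_format, of 0 1 "1/2"]
    by auto
  define \<alpha> \<beta> where "\<alpha> = Inf S" and "\<beta> = Sup S"
  have bdd: "bdd_below S" "bdd_above S"
    using S(1) by (auto intro!: bdd_belowI[of _ 0] bdd_aboveI[of _ 1])
  have "\<alpha> \<le> 1/2" "1/2 \<le> \<beta>" unfolding \<alpha>_def \<beta>_def
    by (rule cInf_lower[OF half bdd(1)], rule cSup_upper[OF half bdd(2)])
  moreover have "0 \<le> \<alpha>" "\<beta> \<le> 1" unfolding \<alpha>_def \<beta>_def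
    using half S(1) by (auto intro!: cInf_greatest cSup_least)
  ultimately have \<alpha>\<beta>: "0 \<le> \<alpha>" "\<alpha> \<le> 1/2" "1/2 \<le> \<beta>" "\<beta> \<le> 1" by auto
  have "\<beta> - \<alpha> \<ge> 1/2"
  proof (rule ccontr)
    assume "\<not> \<beta> - \<alpha> \<ge> 1/2"
    \<comment> \<open>The midpoint between \<open>\<beta> - 1/2\<close> and \<open>\<alpha>\<close>:
      if \<open>S\<close> were too short, it would fit strictly between \<open>a\<close> and
      \<open>a + 1/2\<close>.\<close>
    define a where "a = (\<alpha> + (\<beta> - 1/2)) / 2"
    have a: "a < \<alpha>" "\<beta> < a + 1/2" "0 \<le> a" "a \<le> 1/2"
      using \<open>\<not> \<beta> - \<alpha> \<ge> 1/2\<close> \<alpha>\<beta> by (auto simp: a_def field_simps)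
    have "a \<notin> S" using a(1) bdd cInf_lower[of a S] by (auto simp: \<alpha>_def)
    moreover have "a + 1/2 \<notin> S" using a(2) bdd cSup_upper[of "a + 1/2" S] by (auto simp: \<beta>_def)
    ultimately show False using cover a by auto
  qed
  also have "\<beta> - \<alpha> = measure lborel {\<alpha><..<\<beta>}" using \<alpha>\<beta> by simp
  also have "\<dots> \<le> measure lborel S"
  proof (rule measure_mono_fmeasurable)
    show "{\<alpha><..<\<beta>} \<subseteq> S"
    proof
      fix x assume x: "x \<in> {\<alpha><..<\<beta>}"
      obtain y where "y \<in> S" "y < x" using x half bdd cInf_less_iff[of S x] by (auto simp: \<alpha>_def)
      moreover obtain z where "z \<in> S" "x < z"
        using x half bdd less_cSup_iff[of S x] by (auto simp: \<beta>_def)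
      ultimately show "x \<in> S" using S(2) unfolding is_interval_1 by (meson less_imp_le)
    qed
    have "S \<in> sets borel"
      using S(2) by (simp add: real_interval_borel_measurable)
    moreover have "emeasure lborel S \<le> emeasure lborel {0..1::real}"
      using S(1) by (intro emeasure_mono) auto
    ultimately show "S \<in> fmeasurable lborel"
      by (intro fmeasurableI) (auto intro: order_le_less_trans)
  qed auto
  finally show ?thesis .
qed

section \<open>Tents\<close>

text \<open>At \<open>r = 0\<close> the left leg degenerates; the value \<open>tent 0 0 = 1\<close> is the limit as \<open>p \<rightarrow> 0\<close>.\<close>
definition tent :: "real \<Rightarrow> real \<Rightarrow> real" where
  "tent p r = (if r = 0 then 1 - p else min (1 - p) (p * (1 - r) / r))"

lemma tent_measurable [measurable]: "tent p \<in> borel_measurable borel"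
  unfolding tent_def by measurable

lemma tent_nonneg: "\<lbrakk>0 \<le> p; p \<le> 1; 0 \<le> r; r \<le> 1\<rbrakk> \<Longrightarrow> 0 \<le> tent p r"
  by (simp add: tent_def)

lemma tent_le:
  assumes "0 \<le> p" "0 \<le> r" "r \<le> 1"
  shows "tent p r \<le> 1 - r"
proof (cases "r \<le> p")
  case True
  then show ?thesis by (auto simp: tent_def min_le_iff_disj)
next
  case False
  then have "p / r * (1 - r) \<le> 1 * (1 - r)"
    using assms by (intro mult_right_mono) auto
  then show ?thesis using False assms by (simp add: tent_def min_le_iff_disj)
qed

text \<open>For fixed \<open>r\<close> the tent is a minimum of affine functions of
  \<open>p\<close>.\<close>

lemma tent_concave:
  assumes "0 \<le> u" "0 \<le> w" "u + w = 1"
  shows "u * tent p r + w * tent q r \<le> tent (u * p + w * q) r"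
proof -
  have "u * min a b + w * min c d \<le> u * a + w * c" "u * min a b + w * min c d \<le> u * b + w * d"
    for a b c d :: real
    using assms by (auto intro!: add_mono mult_left_mono)
  from this[of "1 - p" "p * (1 - r) / r" "1 - q" "q * (1 - r) / r"]
  moreover have "u * (1 - p) + w * (1 - q) = 1 - (u * p + w * q)"
    using assms(3) by (simp add: algebra_simps)
  moreover have "u * (p * (1 - r) / r) + w * (q * (1 - r) / r) = (u * p + w * q) * (1 - r) / r"
    by (simp add: algebra_simps flip: add_divide_distrib)
  ultimately show ?thesis by (auto simp: tent_def)
qed

text \<open>The weights give \<open>a\<close> and \<open>a + 1/2\<close> the mean 1/2. If both
  points lie on one leg, where the tent is affine, the sum is the value of that leg at 1/2, namely
  \<open>1/2\<close> or \<open>(1 - r) / (2 * r)\<close>. Only a peak between the two points needs a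
  separate estimate.\<close>

lemma tent_two_point:
  assumes "0 \<le> a" "a \<le> 1/2" "0 \<le> r" "r \<le> 1"
  shows "(1 - r) / 2 \<le> 2 * a * tent a r + (1 - 2 * a) * tent (a + 1/2) r"
proof -
  have high: "tent p r = 1 - p" if "r \<le> p" "p \<le> 1" for p
    using that assms by (auto simp: tent_def field_simps)
  have low: "tent p r = p * ((1 - r) / r)" if "p < r" "0 \<le> p" for p
  proof -
    have "p * (1 - r) \<le> (1 - p) * r" using that by (simp add: algebra_simps)
    then have "p * (1 - r) / r \<le> 1 - p" using that by (simp add: pos_divide_le_eq)
    then show ?thesis using that by (simp add: tent_def min_absorb2)
  qed
  consider "r \<le> a" | "a < r" "r \<le> a + 1/2" | "a + 1/2 < r" by linarith
  then show ?thesis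
  proof cases
    case 1
    then have "2 * a * tent a r + (1 - 2 * a) * tent (a + 1/2) r = 1/2"
      using assms by (simp add: high algebra_simps)
    then show ?thesis using assms by simp
  next
    case 2
    \<comment> \<open>The weights \<open>2a\<close> and \<open>1 - 2a\<close> make this convex function of \<open>r\<close> minimal at \<open>r = 2a\<close> after
       subtracting \<open>(1 - r)/2\<close>, with minimum \<open>0\<close>.\<close>
    have "2 * a * (a * ((1 - r) / r)) + (1 - 2 * a) * (1 - (a + 1/2)) - (1 - r) / 2
        = (2 * a - r)\<^sup>2 / (2 * r)"
      using 2 assms by (simp add: field_simps power2_eq_square)
    also have "\<dots> \<ge> 0" using 2 assms by simp
    finally show ?thesis
      unfolding low[OF 2(1) assms(1)] high[OF 2(2)] using 2 assms by (simp add: high)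
  next
    case 3
    have "2 * a * (a * c) + (1 - 2 * a) * ((a + 1/2) * c) = c / 2" for c :: real
      by (simp add: algebra_simps)
    moreover have "1 - r \<le> (1 - r) / r"
      using 3 assms mult_right_mono[of r 1 "1 - r"] by (simp add: pos_le_divide_eq mult.commute)
    moreover have "tent a r = a * ((1 - r) / r)" "tent (a + 1/2) r = (a + 1/2) * ((1 - r) / r)"
      using 3 assms low[of a] low[of "a + 1/2"] by simp_all
    ultimately show ?thesis by (simp only: divide_right_mono zero_le_numeral)
  qed
qed

text \<open>The antiderivative \<open>- 1 / q\<close> yields \<open>p * (1 / max p r - 1)\<close>,
  and the two cases of the maximum are the two legs.\<close>

lemma tent_eq_nn_integral:
  assumes "0 < p" "p \<le> 1" "0 \<le> r" "r \<le> 1"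
  shows "ennreal p * (\<integral>\<^sup>+q. ennreal (1 / q\<^sup>2) * indicator {max p r..1} q \<partial>lborel) = ennreal (tent p r)"
proof -
  have "(\<integral>\<^sup>+q. ennreal (1 / q\<^sup>2) * indicator {max p r..1} q \<partial>lborel)
      = ennreal (- 1 / 1 - (- 1 / max p r))"
  proof (rule nn_integral_FTC_Icc)
    fix q assume "q \<in> {max p r..1}"
    then show "((\<lambda>q. - 1 / q) has_real_derivative 1 / q\<^sup>2) (at q)"
      using assms by (auto intro!: derivative_eq_intros simp: power2_eq_square)
  qed (use assms in auto)
  then show ?thesis
    using assms by (auto simp: tent_def max_def min_def field_simps simp flip: ennreal_mult)
qed


section \<open>Distribution function and quantiles of an atomless variable\<close>

locale atomless_nonneg_rv = prob_space M for M :: "'a measure" +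
  fixes Z :: "'a \<Rightarrow> real"
  assumes rv [measurable]: "Z \<in> borel_measurable M"
    and nonneg: "AE \<omega> in M. 0 \<le> Z \<omega>"
    and atomless: "\<And>x. prob {\<omega> \<in> space M. Z \<omega> = x} = 0"
begin

definition F :: "real \<Rightarrow> real" where
  "F = cdf (distr M borel Z)"

sublocale D: real_distribution "distr M borel Z"
  by (rule real_distribution_distr) (rule rv)

lemma F_eq: "F t = prob {\<omega> \<in> space M. Z \<omega> \<le> t}"
  by (simp add: F_def cdf_def2 measure_distr vimage_def Int_def conj_commute)

lemma F_mono: "s \<le> t \<Longrightarrow> F s \<le> F t"
  unfolding F_def by (rule D.cdf_nondecreasing)

lemma F_measurable [measurable]: "F \<in> borel_measurable borel"
  by (intro borel_measurable_mono monoI F_mono)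

lemma F_bounds: "0 \<le> F t" "F t \<le> 1"
  by (auto simp: F_eq)

lemma F_0: "F 0 = 0"
proof -
  have "prob {\<omega> \<in> space M. Z \<omega> \<le> 0} = prob {\<omega> \<in> space M. Z \<omega> = 0}"
    using nonneg by (intro measure_eq_AE) auto
  then show ?thesis by (simp add: F_eq atomless)
qed

text \<open>Without atoms \<open>F\<close> is continuous, so the intermediate value theorem applies.
  The value 1 is excluded because an unbounded \<open>Z\<close> may approach it only in the
  limit.\<close>

lemma F_surj:
  assumes "0 \<le> q" "q < 1"
  obtains x where "0 \<le> x" "F x = q"
proof -
  have "eventually (\<lambda>t. q < F t) at_top"
    using order_tendstoD(1)[OF D.cdf_lim_at_top_prob assms(2)] by (simp add: F_def)
  then obtain b where "\<And>t. b \<le> t \<Longrightarrow> q < F t"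
    by (auto simp: eventually_at_top_linorder)
  then have "q < F \<bar>b\<bar>" by simp
  moreover have "isCont F t" for t
    unfolding F_def D.isCont_cdf
    using atomless[of t] by (simp add: measure_distr vimage_def Int_def conj_commute)
  ultimately obtain x where "0 \<le> x" "F x = q"
    using IVT[of F 0 q "\<bar>b\<bar>"] assms F_0 by fastforce
  then show ?thesis by (rule that)
qed

lemma prob_le_ennreal:
  assumes "0 \<le> t"
  shows "prob {\<omega> \<in> space M. ennreal (Z \<omega>) \<le> ennreal t} = F t"
  using assms by (simp add: F_eq ennreal_le_iff)

text \<open>Every level below 1 is attained, so the supremum over the level set of \<open>q\<close>
  is also the supremum of the sublevel set, an initial segment of the half-line. Its length can be
  written as an integral over \<open>t\<close>.\<close>

lemma quantile_eq:
  assumes "0 \<le> q" "q \<le> 1"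
  shows "quantile M Z q = emeasure lborel {t. 0 \<le> t \<and> F t \<le> q}"
proof (rule emeasure_lborel_initial_segment[symmetric])
  fix t :: real
  assume t: "0 \<le> t" "ennreal t < quantile M Z q"
  then obtain x where x: "ennreal t < x" "prob {\<omega> \<in> space M. ennreal (Z \<omega>) \<le> x} = q"
    by (auto simp: quantile_def less_Sup_iff)
  have "F t \<le> q"
    unfolding prob_le_ennreal[OF t(1), symmetric] x(2)[symmetric] using x(1)
    by (intro finite_measure_mono) auto
  then show "t \<in> {t. 0 \<le> t \<and> F t \<le> q}" using t by simp
next
  fix t assume "t \<in> {t. 0 \<le> t \<and> F t \<le> q}"
  then have t: "0 \<le> t" "F t \<le> q" by auto
  have "\<exists>x. ennreal t \<le> x \<and> prob {\<omega> \<in> space M. ennreal (Z \<omega>) \<le> x} = q"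
  proof (cases "q = 1")
    case True
    \<comment> \<open>Level 1 may be attained only at infinity, so the witness is
      \<open>top\<close>.\<close>
    then show ?thesis using prob_space by (intro exI[of _ top]) simp
  next
    case False
    with assms obtain x where x: "0 \<le> x" "F x = q" using F_surj[of q] by auto
    \<comment> \<open>If \<open>t\<close> exceeds \<open>x\<close>, monotonicity squeezes
      \<open>F t\<close> between \<open>F x = q\<close> and \<open>q\<close>.\<close>
    have "F (max t x) = q" using x t F_mono[of x t] by (auto simp: max_def)
    then show ?thesis using t x prob_le_ennreal[of "max t x"]
      by (intro exI[of _ "ennreal (max t x)"]) (auto intro: ennreal_leI)
  qed
  then show "0 \<le> t \<and> ennreal t \<le> quantile M Z q"
    using t by (auto simp: quantile_def intro: Sup_upper2)
qed measurable

section \<open>Integral representations of the guarantee and of the expectation\<close>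

lemma guarantee_pos_eq_nn_integral:
  assumes p: "0 < p" "p \<le> 1"
  shows "guarantee_pos M Z p = (\<integral>\<^sup>+t. ennreal (indicator {0..} t * tent p (F t)) \<partial>lborel)"
proof -
  have "(\<integral>\<^sup>+q\<in>{p..1}. (quantile M Z q / ennreal (q\<^sup>2)) \<partial>lborel)
      = (\<integral>\<^sup>+q. \<integral>\<^sup>+t. ennreal (1 / q\<^sup>2) * indicator {p..1} q * (indicator {0..} t * (if F t \<le> q then 1 else 0))
          \<partial>lborel \<partial>lborel)"
  proof (rule nn_integral_cong)
    fix q :: real
    show "quantile M Z q / ennreal (q\<^sup>2) * indicator {p..1} q
      = (\<integral>\<^sup>+t. ennreal (1 / q\<^sup>2) * indicator {p..1} q * (indicator {0..} t * (if F t \<le> q then 1 else 0)) \<partial>lborel)"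
    proof (cases "q \<in> {p..1}")
      case True
      have "quantile M Z q = (\<integral>\<^sup>+t. indicator {t. 0 \<le> t \<and> F t \<le> q} t \<partial>lborel)"
        using True p by (subst quantile_eq) auto
      also have "\<dots> = (\<integral>\<^sup>+t. indicator {0..} t * (if F t \<le> q then 1 else 0) \<partial>lborel)"
        by (intro nn_integral_cong) (auto simp: indicator_def)
      finally have "quantile M Z q = \<dots>" .
      moreover have "x / ennreal (q\<^sup>2) = ennreal (1 / q\<^sup>2) * x" for x
        using True p by (simp add: divide_ennreal_def inverse_ennreal mult.commute inverse_eq_divide)
      ultimately show ?thesis using True by (simp add: nn_integral_cmult)
    qed simp
  qed
  also have "\<dots> = (\<integral>\<^sup>+t. \<integral>\<^sup>+q. ennreal (1 / q\<^sup>2) * indicator {p..1} q * (indicator {0..} t * (if F t \<le> q then 1 else 0))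
          \<partial>lborel \<partial>lborel)"
    by (intro lborel_pair.Fubini') measurable
  finally have "guarantee_pos M Z p
      = (\<integral>\<^sup>+t. ennreal p * (\<integral>\<^sup>+q. ennreal (1 / q\<^sup>2) * indicator {p..1} q
            * (indicator {0..} t * (if F t \<le> q then 1 else 0)) \<partial>lborel) \<partial>lborel)"
    unfolding guarantee_pos_def by (subst nn_integral_cmult) simp_all
  \<comment> \<open>The constraints \<open>p \<le> q\<close> and \<open>F t \<le> q\<close> merge
    into the lower limit \<open>max p (F t)\<close>.\<close>
  also have "\<dots> = (\<integral>\<^sup>+t. ennreal p * (indicator {0..} t *
      (\<integral>\<^sup>+q. ennreal (1 / q\<^sup>2) * indicator {max p (F t)..1} q \<partial>lborel)) \<partial>lborel)"
    by (intro nn_integral_cong arg_cong2[where f="(*)"] refl, subst nn_integral_cmult[symmetric])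
       (auto intro!: nn_integral_cong simp: indicator_def)
  also have "\<dots> = (\<integral>\<^sup>+t. ennreal (indicator {0..} t * tent p (F t)) \<partial>lborel)"
  proof (intro nn_integral_cong)
    fix t
    show "ennreal p * (indicator {0..} t *
          (\<integral>\<^sup>+q. ennreal (1 / q\<^sup>2) * indicator {max p (F t)..1} q \<partial>lborel))
        = ennreal (indicator {0..} t * tent p (F t))"
      using tent_eq_nn_integral[OF p F_bounds] by (cases "0 \<le> t") simp_all
  qed
  finally show ?thesis .
qed

text \<open>Layer-cake formula: write \<open>Z\<close> as the length of
  \<open>{0..<Z \<omega>}\<close> and exchange integrals. Negative values of \<open>Z\<close>
  contribute 0 on both sides.\<close>

lemma nn_integral_tail:
  "(\<integral>\<^sup>+t. ennreal (indicator {0..} t * (1 - F t)) \<partial>lborel) = (\<integral>\<^sup>+\<omega>. ennreal (Z \<omega>) \<partial>M)"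
proof -
  interpret P: pair_sigma_finite M lborel ..
  have "(\<integral>\<^sup>+\<omega>. ennreal (Z \<omega>) \<partial>M)
      = (\<integral>\<^sup>+\<omega>. \<integral>\<^sup>+t. indicator {0..} t * (if t < Z \<omega> then 1 else 0) \<partial>lborel \<partial>M)"
  proof (intro nn_integral_cong)
    fix \<omega>
    have "ennreal (Z \<omega>) = emeasure lborel {0..<Z \<omega>}"
      by (cases "0 \<le> Z \<omega>") (auto simp: ennreal_neg)
    also have "\<dots> = (\<integral>\<^sup>+t. indicator {0..<Z \<omega>} t \<partial>lborel)" by simp
    also have "\<dots> = (\<integral>\<^sup>+t. indicator {0..} t * (if t < Z \<omega> then 1 else 0) \<partial>lborel)"
      by (intro nn_integral_cong) (auto simp: indicator_def)
    finally show "ennreal (Z \<omega>) = \<dots>" .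
  qed
  also have "\<dots> = (\<integral>\<^sup>+t. \<integral>\<^sup>+\<omega>. indicator {0..} t * (if t < Z \<omega> then 1 else 0) \<partial>M \<partial>lborel)"
    by (intro P.Fubini'[symmetric]) measurable
  also have "\<dots> = (\<integral>\<^sup>+t. ennreal (indicator {0..} t * (1 - F t)) \<partial>lborel)"
  proof (intro nn_integral_cong)
    fix t :: real
    have "(\<integral>\<^sup>+\<omega>. (if t < Z \<omega> then 1 else 0) \<partial>M) = (\<integral>\<^sup>+\<omega>. indicator {\<omega> \<in> space M. \<not> Z \<omega> \<le> t} \<omega> \<partial>M)"
      by (intro nn_integral_cong) (auto simp: indicator_def)
    also have "\<dots> = ennreal (prob {\<omega> \<in> space M. \<not> Z \<omega> \<le> t})"
      by (simp add: emeasure_eq_measure)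
    also have "\<dots> = ennreal (1 - F t)"
      by (subst prob_neg) (auto simp: F_eq)
    finally show "(\<integral>\<^sup>+\<omega>. indicator {0..} t * (if t < Z \<omega> then 1 else 0) \<partial>M) = ennreal (indicator {0..} t * (1 - F t))"
      by (simp add: nn_integral_cmult) (simp add: indicator_def)
  qed
  finally show ?thesis by simp
qed

end

section \<open>The guarantee as a concave real function\<close>

locale integrable_atomless_nonneg_rv = atomless_nonneg_rv +
  assumes integrable: "integrable M Z"
begin

text \<open>A real-valued form of the guarantee, suited to concavity arguments. The formula makes
  sense at \<open>p = 0\<close> as well, where it gives the limit from the right.\<close>

definition T :: "real \<Rightarrow> real" where
  "T p = (\<integral>t. indicator {0..} t * tent p (F t) \<partial>lborel)"

lemma has_bochner_integral_tail:
  "has_bochner_integral lborel (\<lambda>t. indicator {0..} t * (1 - F t)) (expectation Z)"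
proof (rule has_bochner_integral_nn_integral)
  show "(\<integral>\<^sup>+t. ennreal (indicator {0..} t * (1 - F t)) \<partial>lborel) = ennreal (expectation Z)"
    unfolding nn_integral_tail by (rule nn_integral_eq_integral[OF integrable nonneg])
qed (use F_bounds nonneg in \<open>auto intro: integral_nonneg_AE\<close>)

text \<open>A majorant independent of \<open>p\<close>, serving both integrability and dominated
  convergence.\<close>

lemma abs_tent_le_tail:
  assumes "0 \<le> p" "p \<le> 1"
  shows "\<bar>indicator {0..} t * tent p (F t)\<bar> \<le> indicator {0..} t * (1 - F t)"
  using assms F_bounds by (auto simp: indicator_def abs_of_nonneg tent_nonneg tent_le)

lemma integrable_tent:
  assumes "0 \<le> p" "p \<le> 1"
  shows "integrable lborel (\<lambda>t. indicator {0..} t * tent p (F t))"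
  by (rule Bochner_Integration.integrable_bound
        [OF has_bochner_integral_tail[THEN integrable.intros]])
     (use abs_tent_le_tail[OF assms] in \<open>auto intro!: AE_I2 intro: order_trans[OF _ abs_ge_self]\<close>)

lemma guarantee_pos_eq:
  assumes "0 < p" "p \<le> 1"
  shows "guarantee_pos M Z p = ennreal (T p)"
  unfolding guarantee_pos_eq_nn_integral[OF assms] T_def
  using assms F_bounds
  by (intro nn_integral_eq_integral integrable_tent) (auto simp: tent_nonneg)

lemma T_tendsto_0: "(T \<longlongrightarrow> T 0) (at_right 0)"
  \<comment> \<open>The substitution \<open>p = inverse i\<close> brings the limit into the form of
    dominated convergence at infinity.\<close>
  unfolding filterlim_at_right_to_top T_def
proof (rule integral_dominated_convergence_at_top)
  show "integrable lborel (\<lambda>t. indicator {0..} t * (1 - F t))"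
    using has_bochner_integral_tail by (rule integrable.intros)
  have "((\<lambda>p. tent p r) \<longlongrightarrow> tent 0 r) (at_right 0)" for r
    unfolding tent_def by (auto intro!: tendsto_eq_intros)
  then show "AE t in lborel. ((\<lambda>i. indicator {0..} t * tent (inverse i) (F t))
      \<longlongrightarrow> indicator {0..} t * tent 0 (F t)) at_top"
    unfolding filterlim_at_right_to_top by (intro AE_I2 tendsto_intros)
  show "\<forall>\<^sub>F i in at_top. AE t in lborel. norm (indicator {0..} t * tent (inverse i) (F t))
      \<le> indicator {0..} t * (1 - F t)"
    \<comment> \<open>For \<open>i \<ge> 1\<close> the point \<open>inverse i\<close> lies in the
      unit interval, where the majorant is valid.\<close>
    using eventually_ge_at_top[of 1]
    by eventually_elim (intro AE_I2, simp only: real_norm_def, rule abs_tent_le_tail, auto simp: field_simps)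
qed measurable

lemma guarantee_eq:
  assumes "0 \<le> p" "p \<le> 1"
  shows "guarantee M Z p = ennreal (T p)"
proof (cases "p = 0")
  case True
  have "((\<lambda>p. ennreal (T p)) \<longlongrightarrow> ennreal (T 0)) (at_right 0)"
    by (intro tendsto_ennrealI T_tendsto_0)
  moreover have "\<forall>\<^sub>F p in at_right 0. guarantee_pos M Z p = ennreal (T p)"
    using eventually_at_right_real[OF zero_less_one]
    by eventually_elim (simp add: guarantee_pos_eq)
  ultimately have "(guarantee_pos M Z \<longlongrightarrow> ennreal (T 0)) (at_right 0)"
    by (simp add: tendsto_cong)
  then show ?thesis
    using True by (simp add: guarantee_def tendsto_Lim)
qed (use assms in \<open>simp add: guarantee_def guarantee_pos_eq\<close>)

lemma T_concave: "concave_on {0..1} T"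
  unfolding concave_on_iff
proof safe
  fix p q u w :: real
  assume *: "p \<in> {0..1}" "q \<in> {0..1}" "0 \<le> u" "0 \<le> w" "u + w = 1"
  have mix: "u *\<^sub>R p + w *\<^sub>R q \<in> {0..1}"
    using convexD[OF convex_closed_interval *] by simp
  have "u * T p + w * T q
      = (\<integral>t. u * (indicator {0..} t * tent p (F t)) + w * (indicator {0..} t * tent q (F t)) \<partial>lborel)"
    using * by (simp add: T_def integrable_tent)
  also have "\<dots> \<le> T (u *\<^sub>R p + w *\<^sub>R q)"
    unfolding T_def using * mix
    by (intro integral_mono Bochner_Integration.integrable_add integrable_mult_right integrable_tent)
       (auto simp: indicator_def intro: tent_concave)
  finally show "u * T p + w * T q \<le> T (u *\<^sub>R p + w *\<^sub>R q)" .
qed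

text \<open>Integrate \<open>tent_two_point\<close> at \<open>r = F t\<close>; the tail
  \<open>1 - F t\<close> integrates to the expectation.\<close>

lemma T_two_point:
  assumes "0 \<le> a" "a \<le> 1/2"
  shows "expectation Z / 2 \<le> 2 * a * T a + (1 - 2 * a) * T (a + 1/2)"
proof -
  let ?f = "\<lambda>p t. indicator {0..} t * tent p (F t)"
  have "expectation Z / 2 = (\<integral>t. indicator {0..} t * (1 - F t) / 2 \<partial>lborel)"
    using has_bochner_integral_tail by (simp add: has_bochner_integral_iff)
  also have "\<dots> \<le> (\<integral>t. 2 * a * ?f a t + (1 - 2 * a) * ?f (a + 1/2) t \<partial>lborel)"
  proof (intro integral_mono Bochner_Integration.integrable_add integrable_mult_right
      integrable_tent integrable_divide_zero)
    show "indicator {0..} t * (1 - F t) / 2 \<le> 2 * a * ?f a t + (1 - 2 * a) * ?f (a + 1/2) t" for t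
      using tent_two_point[OF assms F_bounds] by (simp add: indicator_def)
  qed (use assms has_bochner_integral_tail in \<open>auto simp: has_bochner_integral_iff\<close>)
  also have "\<dots> = 2 * a * T a + (1 - 2 * a) * T (a + 1/2)"
    using assms by (simp add: T_def integrable_tent)
  finally show ?thesis .
qed

section \<open>The competitive set and the prophet\<close>

lemma competitive_set:
  defines "S \<equiv> {p \<in> {0..1}. guarantee M Z p \<ge> ennreal (expectation Z / 2)}"
  shows "is_interval S" and "1/2 \<le> measure lborel S"
proof -
  have T_nonneg: "0 \<le> T p" if "p \<in> {0..1}" for p
    unfolding T_def using that F_bounds by (auto intro!: integral_nonneg simp: tent_nonneg)
  have S_eq: "S = {p \<in> {0..1}. T p \<ge> expectation Z / 2}"
    unfolding S_def using T_nonneg by (auto simp: guarantee_eq ennreal_le_iff)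
  show int: "is_interval S"
    unfolding is_interval_convex_1
  proof (rule convexI)
    fix p q u w :: real
    assume *: "p \<in> S" "q \<in> S" "0 \<le> u" "0 \<le> w" "u + w = 1"
    have "expectation Z / 2 = u * (expectation Z / 2) + w * (expectation Z / 2)"
      unfolding distrib_right[symmetric] *(5) by simp
    also have "\<dots> \<le> u * T p + w * T q"
      using * by (intro add_mono mult_left_mono) (auto simp: S_eq)
    also have "\<dots> \<le> T (u *\<^sub>R p + w *\<^sub>R q)"
      using T_concave * by (auto simp: concave_on_iff S_eq)
    finally show "u *\<^sub>R p + w *\<^sub>R q \<in> S"
      using convexD[OF convex_closed_interval[of 0 "1::real"] _ _ *(3-5)] * by (auto simp: S_eq)
  qed
  show "1/2 \<le> measure lborel S"
  proof (rule interval_measure_ge_half[OF _ int])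
    fix a :: real
    assume a: "0 \<le> a" "a \<le> 1/2"
    show "a \<in> S \<or> a + 1/2 \<in> S"
    proof (rule ccontr)
      assume "\<not> (a \<in> S \<or> a + 1/2 \<in> S)"
      then have "T a < expectation Z / 2" "T (a + 1/2) < expectation Z / 2"
        using a by (auto simp: S_eq)
      \<comment> \<open>A convex combination of two values strictly below the threshold stays
        strictly below, even if one weight is 0.\<close>
      then have "2 * a * T a + (1 - 2 * a) * T (a + 1/2) < expectation Z / 2"
        using a by (intro convex_bound_lt) auto
      then show False using T_two_point[OF a] by simp
    qed
  qed (auto simp: S_eq)
qed

end

theorem claim11:
  fixes M :: "'a measure" and n :: nat and v :: "nat \<Rightarrow> 'a \<Rightarrow> real"
  assumes "prob_space M"
    and "n \<ge> 1"
    and "prob_space.indep_vars M (\<lambda>_. borel) v {1..n}"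
    and "\<And>i. i \<in> {1..n} \<Longrightarrow> AE \<omega> in M. 0 \<le> v i \<omega>"
    and "\<And>i x. i \<in> {1..n} \<Longrightarrow> measure M {\<omega> \<in> space M. v i \<omega> = x} = 0"
    and "integrable M (prophet n v)"
    and "integral\<^sup>L M (prophet n v) = 1"
  shows "is_interval {p \<in> {0..1}. guarantee M (prophet n v) p \<ge> 1/2} \<and>
         measure lborel {p \<in> {0..1}. guarantee M (prophet n v) p \<ge> 1/2} \<ge> 1/2"
proof -
  interpret prob_space M by fact
  have rv [measurable]: "v i \<in> borel_measurable M" if "i \<in> {1..n}" for i
    using assms(3) that by (auto simp: indep_vars_def)
  have attained: "\<exists>i\<in>{1..n}. prophet n v \<omega> = v i \<omega>" for \<omega>
    using Max_in[of "(\<lambda>i. v i \<omega>) ` {1..n}"] assms(2) by (auto simp: prophet_def simp del: Max_in)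
  interpret integrable_atomless_nonneg_rv M "prophet n v"
  proof
    show "prophet n v \<in> borel_measurable M"
      using assms(6) by (rule borel_measurable_integrable)
    have "AE \<omega> in M. \<forall>i\<in>{1..n}. 0 \<le> v i \<omega>"
      using assms(4) by (intro AE_finite_allI) auto
    then show "AE \<omega> in M. 0 \<le> prophet n v \<omega>"
      by eventually_elim (metis attained)
    show "prob {\<omega> \<in> space M. prophet n v \<omega> = x} = 0" for x
    proof -
      have ev: "{\<omega> \<in> space M. v i \<omega> = x} \<in> events" if "i \<in> {1..n}" for i
        using rv[OF that] by measurable
      \<comment> \<open>The maximum is attained by some reward, so an atom of the prophet is covered
        by atoms of the rewards, and a union bound gives 0.\<close>
      have "{\<omega> \<in> space M. prophet n v \<omega> = x} \<subseteq> (\<Union>i\<in>{1..n}. {\<omega> \<in> space M. v i \<omega> = x})"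
      proof
        fix \<omega> assume "\<omega> \<in> {\<omega> \<in> space M. prophet n v \<omega> = x}"
        then show "\<omega> \<in> (\<Union>i\<in>{1..n}. {\<omega> \<in> space M. v i \<omega> = x})"
          using attained[of \<omega>] by auto
      qed
      then have "prob {\<omega> \<in> space M. prophet n v \<omega> = x}
          \<le> prob (\<Union>i\<in>{1..n}. {\<omega> \<in> space M. v i \<omega> = x})"
        using ev by (intro finite_measure_mono) auto
      also have "\<dots> \<le> (\<Sum>i\<in>{1..n}. prob {\<omega> \<in> space M. v i \<omega> = x})"
        using ev by (intro finite_measure_subadditive_finite) auto
      also have "\<dots> = 0" using assms(5) by simp
      finally show ?thesis by (simp add: measure_le_0_iff)
    qed
  qed fact
  \<comment> \<open>The \<open>1/2\<close> of the statement is a quotient of extended reals, to be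
    identified with the embedded real number.\<close>
  have "ennreal 1 / ennreal 2 = ennreal (1 / 2)"
    by (rule divide_ennreal) simp_all
  then have half: "(1/2 :: ennreal) = ennreal (expectation (prophet n v) / 2)"
    by (simp only: assms(7) ennreal_1 ennreal_numeral zero_le_numeral)
  show ?thesis unfolding half by (intro conjI competitive_set)
qed

end
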